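(* Let $0<\beta<1$. Then, for all $q(\cdot)\in\mathscr{B}(\mathbb{R}^n)$, $\dot{\Lambda}_{\beta}(\mathbb{R}^n)=\dot{\Lambda}_{\beta,q(\cdot)}(\mathbb{R}^n)$. Furthermore, for each such $q(\cdot)$ there exist positive constants $C_1$ and $C_2$ such that, for all $b\in\dot{\Lambda}_{\beta}(\mathbb{R}^n)$, $$C_1\|b\|_{\dot{\Lambda}_{\beta}}\le\|b\|_{\dot{\Lambda}_{\beta,q(\cdot)}}\le C_2\|b\|_{\dot{\Lambda}_{\beta}}.$$
   Context: Functions are real-valued and identified when equal almost everywhere; in particular $b\in\dot{\Lambda}_\beta(\mathbb{R}^n)$ means that $b$ agrees a.e. with a function satisfying the condition below. A cube $Q\subset\mathbb{R}^n$ always has sides parallel to the coordinate axes; $|Q|$ is its Lebesgue measure, $\chi_Q$ its characteristic function, and $f_Q=|Q|^{-1}\int_Q f(x)\,dx$ for $f\in L^1_{\rm loc}(\mathbb{R}^n)$. Lipschitz space: for $0<\beta<1$, $b\in\dot{\Lambda}_{\beta}(\mathbb{R}^n)$ if there is a constant $C$ with $|b(x)-b(y)|\le C|x-y|^{\beta}$ for all $x,y\in\mathbb{R}^n$; the smallest such $C$ is denoted $\|b\|_{\dot{\Lambda}_{\beta}}$. Hardy-Littlewood maximal function: $M(f)(x)=\sup_{Q\ni x}\frac1{|Q|}\int_Q|f(y)|\,dy$, the supremum over all cubes $Q\subset\mathbb{R}^n$ containing $x$. Variable exponent Lebesgue space: for measurable $p(\cdot):\mathbb{R}^n\to[1,\infty)$,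 $L^{p(\cdot)}(\mathbb{R}^n)$ is the set of measurable $f$ with $\int_{\mathbb{R}^n}(|f(x)|/\lambda)^{p(x)}dx<\infty$ for some $\lambda>0$, with norm $\|f\|_{L^{p(\cdot)}(\mathbb{R}^n)}=\inf\{\lambda>0:\int_{\mathbb{R}^n}(|f(x)|/\lambda)^{p(x)}dx\le1\}$ (equal to $\infty$ if $f\notin L^{p(\cdot)}(\mathbb{R}^n)$). $\mathscr{P}(\mathbb{R}^n)$ is the set of measurable $p(\cdot):\mathbb{R}^n\to[1,\infty)$ with $1<\operatorname{ess\,inf}_{x}p(x)$ and $\operatorname{ess\,sup}_{x}p(x)<\infty$. $\mathscr{B}(\mathbb{R}^n)$ is the set of $p(\cdot)\in\mathscr{P}(\mathbb{R}^n)$ such that $M$ is bounded on $L^{p(\cdot)}(\mathbb{R}^n)$. For $0<\beta<1$ and $q(\cdot)\in\mathscr{B}(\mathbb{R}^n)$, $\dot{\Lambda}_{\beta,q(\cdot)}(\mathbb{R}^n)$ is the set of $b\in L^1_{\rm loc}(\mathbb{R}^n)$ with $$\|b\|_{\dot{\Lambda}_{\beta,q(\cdot)}}=\sup_{Q}\frac1{|Q|^{\beta/n}}\frac{\|(b-b_Q)\chi_Q\|_{L^{q(\cdot)}(\mathbb{R}^n)}}{\|\chi_Q\|_{L^{q(\cdot)}(\mathbb{R}^n)}}<\infty,$$ the supremum over all cubes $Q\subset\mathbb{R}^n$. *)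

theory Defs
  imports "HOL-Analysis.Analysis" "HOL-Probability.Essential_Supremum"
begin

text \<open>
  The Euclidean space of dimension \<open>n\<close> is the type \<open>real ^ 'n\<close>, with \<open>n = CARD('n)\<close>. Functions are
  genuine functions on it; every space below is closed under equality almost everywhere and every
  norm is invariant under it. Measurable means Lebesgue measurable. Quantities that may
  be infinite take values in \<open>ennreal\<close>.
\<close>

text \<open>Cubes are closed and nondegenerate. Their boundaries are null sets.\<close>

definition cubes :: "(real ^ 'n) set set" where
  "cubes = {cbox a (\<chi> i. a $ i + l) | a l. 0 < l}"

definition L1_loc :: "(real ^ 'n \<Rightarrow> real) set" where
  "L1_loc = {f. f \<in> borel_measurable lebesgue \<and> (\<forall>K. compact K \<longrightarrow> set_integrable lebesgue K f)}"

definition cube_avg :: "(real ^ 'n) set \<Rightarrow> (real ^ 'n \<Rightarrow> real) \<Rightarrow> real" where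
  "cube_avg Q f = (1 / measure lebesgue Q) * (LINT x:Q|lebesgue. f x)"

definition lip_bound :: "real \<Rightarrow> (real ^ 'n \<Rightarrow> real) \<Rightarrow> real \<Rightarrow> bool" where
  "lip_bound \<beta> g C \<longleftrightarrow> (\<forall>x y. \<bar>g x - g y\<bar> \<le> C * norm (x - y) powr \<beta>)"

definition lip_space :: "real \<Rightarrow> (real ^ 'n \<Rightarrow> real) set" where
  "lip_space \<beta> = {b. \<exists>g C. (AE x in lebesgue. b x = g x) \<and> lip_bound \<beta> g C}"

definition lip_norm :: "real \<Rightarrow> (real ^ 'n \<Rightarrow> real) \<Rightarrow> real" where
  "lip_norm \<beta> b = (LEAST C. \<exists>g. (AE x in lebesgue. b x = g x) \<and> lip_bound \<beta> g C)"

definition maximal_fun :: "(real ^ 'n \<Rightarrow> real) \<Rightarrow> real ^ 'n \<Rightarrow> ennreal" where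
  "maximal_fun f x =
     (SUP Q \<in> {Q \<in> cubes. x \<in> Q}. (\<integral>\<^sup>+ y \<in> Q. ennreal \<bar>f y\<bar> \<partial>lebesgue) / emeasure lebesgue Q)"

definition modular :: "(real ^ 'n \<Rightarrow> real) \<Rightarrow> (real ^ 'n \<Rightarrow> real) \<Rightarrow> real \<Rightarrow> ennreal" where
  "modular p f t = (\<integral>\<^sup>+ x. ennreal ((\<bar>f x\<bar> / t) powr p x) \<partial>lebesgue)"

definition Lp_var :: "(real ^ 'n \<Rightarrow> real) \<Rightarrow> (real ^ 'n \<Rightarrow> real) set" where
  "Lp_var p = {f. f \<in> borel_measurable lebesgue \<and> (\<exists>t>0. modular p f t < \<infinity>)}"

definition Lp_var_norm :: "(real ^ 'n \<Rightarrow> real) \<Rightarrow> (real ^ 'n \<Rightarrow> real) \<Rightarrow> ennreal" where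
  "Lp_var_norm p f =
     (if f \<in> Lp_var p then Inf {ennreal t | t. 0 < t \<and> modular p f t \<le> 1} else \<infinity>)"

text \<open>The library provides only the essential supremum.\<close>

definition essinf :: "'a measure \<Rightarrow> ('a \<Rightarrow> ereal) \<Rightarrow> ereal" where
  "essinf M f = - esssup M (\<lambda>x. - f x)"

definition exponents_P :: "(real ^ 'n \<Rightarrow> real) set" where
  "exponents_P = {p. p \<in> borel_measurable lebesgue \<and> (\<forall>x. 1 \<le> p x) \<and>
     1 < essinf lebesgue (\<lambda>x. ereal (p x)) \<and> esssup lebesgue (\<lambda>x. ereal (p x)) < \<infinity>}"

text \<open>
  The maximal function takes values in \<open>[0, \<infinity>]\<close>, whereas \<open>Lp_var\<close> consists of real-valued functions.
  Hence boundedness includes that the maximal function is finite almost everywhere; the conversion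
  \<open>enn2real\<close>, which sends infinity to 0, then alters it only on a null set.
\<close>

definition exponents_B :: "(real ^ 'n \<Rightarrow> real) set" where
  "exponents_B = {p \<in> exponents_P. \<exists>C::real. \<forall>f \<in> Lp_var p.
     (AE x in lebesgue. maximal_fun f x < \<infinity>) \<and>
     Lp_var_norm p (\<lambda>x. enn2real (maximal_fun f x)) \<le> ennreal C * Lp_var_norm p f}"

definition lip_mean_norm ::
    "real \<Rightarrow> (real ^ 'n \<Rightarrow> real) \<Rightarrow> (real ^ 'n \<Rightarrow> real) \<Rightarrow> ennreal" where
  "lip_mean_norm \<beta> q b =
     (SUP Q \<in> cubes. ennreal (1 / measure lebesgue Q powr (\<beta> / real CARD('n))) *
        (Lp_var_norm q (\<lambda>x. (b x - cube_avg Q b) * indicator Q x) / Lp_var_norm q (indicator Q)))"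

definition lip_mean_space :: "real \<Rightarrow> (real ^ 'n \<Rightarrow> real) \<Rightarrow> (real ^ 'n \<Rightarrow> real) set" where
  "lip_mean_space \<beta> q = {b \<in> L1_loc. lip_mean_norm \<beta> q b < \<infinity>}"

text \<open>The least constant exists, so the description operator in \<open>lip_norm\<close> is meaningful.\<close>

lemma lip_bound_nonneg:
  fixes g :: "real ^ 'n \<Rightarrow> real"
  assumes "lip_bound \<beta> g C"
  shows "0 \<le> C"
proof -
  have "\<bar>g (axis undefined 1) - g 0\<bar> \<le> C * norm (axis undefined 1 - (0::real^'n)) powr \<beta>"
    using assms unfolding lip_bound_def by blast
  then have "\<bar>g (axis undefined 1) - g 0\<bar> \<le> C"
    by (simp add: norm_axis_1)
  then show ?thesis
    by linarith
qed

lemma lip_bound_continuous: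
  fixes g :: "real ^ 'n \<Rightarrow> real"
  assumes "lip_bound \<beta> g C" "0 < \<beta>"
  shows "continuous_on UNIV g"
proof (unfold continuous_on, intro ballI)
  fix x :: "real ^ 'n"
  have n: "((\<lambda>y. norm (y - x)) \<longlongrightarrow> 0) (at x)"
    by (rule tendsto_eq_intros refl | simp)+
  have "((\<lambda>y. norm (y - x) powr \<beta>) \<longlongrightarrow> 0 powr \<beta>) (at x)"
    by (rule tendsto_powr'[OF n tendsto_const]) (use assms(2) in auto)
  then have "((\<lambda>y. C * norm (y - x) powr \<beta>) \<longlongrightarrow> 0) (at x)"
    using tendsto_mult_right_zero by fastforce
  then have "((\<lambda>y. g y - g x) \<longlongrightarrow> 0) (at x)"
    by (rule Lim_null_comparison[rotated])
      (use assms(1) in \<open>auto simp: lip_bound_def intro!: always_eventually\<close>)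
  then show "(g \<longlongrightarrow> g x) (at x within UNIV)"
    by (simp add: LIM_zero_iff)
qed

lemma AE_lebesgue_continuous_eq:
  fixes f g :: "real ^ 'n \<Rightarrow> real"
  assumes "continuous_on UNIV f" "continuous_on UNIV g" "AE x in lebesgue. f x = g x"
  shows "f = g"
proof -
  have op: "open {x. f x \<noteq> g x}"
    using assms(1,2) by (intro open_Collect_neq)
  have "AE x in lborel. x \<notin> {x. f x \<noteq> g x}"
    using assms(3) by (simp add: AE_completion_iff)
  then have "{x. f x \<noteq> g x} \<in> null_sets lborel"
    using op by (subst (asm) AE_iff_null_sets[symmetric]) auto
  then have "negligible {x. f x \<noteq> g x}"
    unfolding negligible_iff_null_sets by (rule null_sets_completionI)
  then have "{x. f x \<noteq> g x} = {}"
    using op open_not_negligible by blast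
  then show ?thesis by auto
qed

lemma lip_norm_least:
  fixes b :: "real ^ 'n \<Rightarrow> real"
  assumes "0 < \<beta>" "b \<in> lip_space \<beta>"
  shows "\<exists>g. (AE x in lebesgue. b x = g x) \<and> lip_bound \<beta> g (lip_norm \<beta> b)"
    and "\<And>g C. AE x in lebesgue. b x = g x \<Longrightarrow> lip_bound \<beta> g C \<Longrightarrow> lip_norm \<beta> b \<le> C"
proof -
  obtain g C0 where g: "AE x in lebesgue. b x = g x" "lip_bound \<beta> g C0"
    using assms(2) unfolding lip_space_def by blast
  define S where "S = {C. lip_bound \<beta> g C}"
  have uniq: "h = g" if "AE x in lebesgue. b x = h x" "lip_bound \<beta> h C" for h C
  proof (rule AE_lebesgue_continuous_eq)
    show "AE x in lebesgue. h x = g x"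
      using that(1) g(1) by eventually_elim simp
  qed (use that g assms(1) lip_bound_continuous in blast)+
  have iff: "(\<exists>h. (AE x in lebesgue. b x = h x) \<and> lip_bound \<beta> h C) \<longleftrightarrow> C \<in> S" for C
    using uniq g(1) unfolding S_def by blast
  have bdd: "bdd_below S"
    using lip_bound_nonneg unfolding S_def by (intro bdd_belowI[of _ 0]) blast
  have ne: "S \<noteq> {}"
    using g(2) unfolding S_def by blast
  have "S = (\<Inter>x. \<Inter>y. {C. \<bar>g x - g y\<bar> \<le> C * norm (x - y) powr \<beta>})"
    unfolding S_def lip_bound_def by auto
  also have "closed \<dots>"
    by (intro closed_INT ballI closed_Collect_le continuous_intros)
  finally have "closed S" .
  then have inS: "Inf S \<in> S"
    using bdd ne closed_contains_Inf by blast
  have eq: "lip_norm \<beta> b = Inf S"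
    unfolding lip_norm_def iff
    by (rule Least_equality) (use inS bdd in \<open>auto intro: cInf_lower\<close>)
  show "\<exists>g. (AE x in lebesgue. b x = g x) \<and> lip_bound \<beta> g (lip_norm \<beta> b)"
    using inS unfolding eq iff .
  show "lip_norm \<beta> b \<le> C" if "AE x in lebesgue. b x = h x" "lip_bound \<beta> h C" for h C
    unfolding eq using that iff bdd by (intro cInf_lower) blast+
qed

end

theory Submission
  imports Defs
begin

text \<open>
  A Hoelder function oscillates by at most a multiple of \<open>l powr \<beta>\<close> on a cube of side \<open>l\<close>, which
  bounds the mean norm. Conversely, boundedness of the maximal operator turns the mean norm into a
  bound for the \<open>L\<^sup>1\<close> mean oscillation. By telescoping over shrinking cubes, the averages of \<open>b\<close>
  then converge uniformly to a Hoelder function \<open>g\<close>. The integral of \<open>\<bar>b - g\<bar>\<close> over a cube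
  of side \<open>l\<close> is of order \<open>l powr (n + \<beta>)\<close>; cutting a cube into \<open>N ^ n\<close> equal pieces and letting
  \<open>N\<close> tend to infinity gives \<open>b = g\<close> almost everywhere, without the Lebesgue differentiation theorem.
\<close>

section \<open>Cubes given by lowest corner and side length\<close>

definition cube :: "real ^ 'n \<Rightarrow> real \<Rightarrow> (real ^ 'n) set" where
  "cube a l = cbox a (\<chi> i. a $ i + l)"

lemma mem_cube: "x \<in> cube a l \<longleftrightarrow> (\<forall>i. a $ i \<le> x $ i \<and> x $ i \<le> a $ i + l)"
  by (simp add: cube_def mem_box_cart)

lemma cubes_eq: "cubes = {cube a l |a l. 0 < l}"
  by (simp add: cubes_def cube_def)

lemma cube_in_cubes: "0 < l \<Longrightarrow> cube a l \<in> cubes"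
  by (auto simp: cubes_eq)

lemma compact_cube: "compact (cube a l)"
  by (simp add: cube_def)

lemma lmeasurable_cube: "cube a l \<in> lmeasurable"
  by (simp add: cube_def)

lemma sets_cube [measurable, simp]: "cube a l \<in> sets lebesgue"
  using lmeasurable_cube by (rule fmeasurableD)

lemma cube_mono: "l \<le> m \<Longrightarrow> cube a l \<subseteq> cube a m"
  by (auto simp: subset_iff mem_cube) (meson add_left_mono order_trans)

lemma measure_cube:
  fixes a :: "real ^ 'n"
  assumes "0 \<le> l"
  shows "measure lebesgue (cube a l) = l ^ CARD('n)"
proof -
  have "cbox a (\<chi> i. a $ i + l) \<noteq> {}"
    using assms by (simp add: interval_ne_empty_cart)
  then have "measure lborel (cbox a (\<chi> i. a $ i + l)) = (\<Prod>i\<in>(UNIV::'n set). l)"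
    by (simp add: content_cbox_cart)
  then show ?thesis
    by (simp add: cube_def)
qed

lemma emeasure_cube:
  fixes a :: "real ^ 'n"
  assumes "0 \<le> l"
  shows "emeasure lebesgue (cube a l) = ennreal (l ^ CARD('n))"
  using measure_cube[OF assms, of a] lmeasurable_cube[of a l]
  by (metis emeasure_eq_measure2)

text \<open>Turns the normalising factor of the mean norm into a power of the side length.\<close>

lemma measure_cube_powr:
  fixes a :: "real ^ 'n"
  assumes "0 < l"
  shows "measure lebesgue (cube a l) powr (\<beta> / real CARD('n)) = l powr \<beta>"
  using assms by (simp add: measure_cube powr_powr flip: powr_realpow)

text \<open>The sum of the coordinate differences is a crude but sufficient bound for the diameter;
  it is the source of the factor \<open>CARD('n) powr \<beta>\<close> in the upper estimate.\<close>

lemma norm_diff_cube: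
  fixes a :: "real ^ 'n"
  assumes "x \<in> cube a l" "y \<in> cube a l"
  shows "norm (x - y) \<le> real CARD('n) * l"
proof -
  have "norm (x - y) \<le> (\<Sum>i\<in>UNIV. \<bar>(x - y) $ i\<bar>)"
    by (rule norm_le_l1_cart)
  also have "\<dots> \<le> (\<Sum>i\<in>(UNIV::'n set). l)"
  proof (rule sum_mono)
    fix i
    show "\<bar>(x - y) $ i\<bar> \<le> l"
      using assms[unfolded mem_cube, rule_format, of i] by auto
  qed
  finally show ?thesis by simp
qed

section \<open>The variable exponent norm and its values on cubes\<close>

lemma Lp_var_norm_le:
  assumes "f \<in> borel_measurable lebesgue" "0 < t" "modular p f t \<le> 1"
  shows "Lp_var_norm p f \<le> ennreal t"
proof -
  have "f \<in> Lp_var p"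
    using assms unfolding Lp_var_def
    by (auto intro!: exI[of _ t] intro: le_less_trans)
  then show ?thesis
    unfolding Lp_var_norm_def using assms by (auto intro!: Inf_lower)
qed

text \<open>Membership in \<open>Lp_var\<close> can be left open, since outside it the norm is
  infinite.\<close>

lemma Lp_var_norm_ge:
  assumes "\<And>t. 0 < t \<Longrightarrow> modular p f t \<le> 1 \<Longrightarrow> c \<le> ennreal t"
  shows "c \<le> Lp_var_norm p f"
  using assms unfolding Lp_var_norm_def by (auto intro!: Inf_greatest)

lemma Lp_var_norm_0: "Lp_var_norm p (\<lambda>x. 0) = 0"
proof -
  have "Lp_var_norm p (\<lambda>x. 0) \<le> 0"
  proof (rule ennreal_le_epsilon)
    fix e :: real assume "0 < e"
    then have "Lp_var_norm p (\<lambda>x. 0) \<le> ennreal e"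
      by (intro Lp_var_norm_le) (auto simp: modular_def)
    then show "Lp_var_norm p (\<lambda>x. 0) \<le> 0 + ennreal e" by simp
  qed
  then show ?thesis by simp
qed

text \<open>For positive \<open>c\<close>, every \<open>t\<close> admissible for \<open>g\<close>
  makes \<open>t / c\<close> admissible for \<open>f\<close>. This gives monotonicity and
  homogeneity at once.\<close>

lemma cmult_Lp_var_norm_le:
  assumes f: "f \<in> borel_measurable lebesgue" and p: "\<And>x. 0 \<le> p x" and c: "0 \<le> c"
    and le: "AE x in lebesgue. c * \<bar>f x\<bar> \<le> \<bar>g x\<bar>"
  shows "ennreal c * Lp_var_norm p f \<le> Lp_var_norm p g"
proof (cases "c = 0")
  case False
  with c have c: "0 < c" by simp
  show ?thesis
  proof (rule Lp_var_norm_ge)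
    fix t :: real assume t: "0 < t" "modular p g t \<le> 1"
    have "modular p f (t / c) \<le> modular p g t"
      unfolding modular_def
    proof (rule nn_integral_mono_AE)
      show "AE x in lebesgue. ennreal ((\<bar>f x\<bar> / (t / c)) powr p x) \<le> ennreal ((\<bar>g x\<bar> / t) powr p x)"
        using le
      proof eventually_elim
        case (elim x)
        show ?case
          using elim c t p by (intro ennreal_leI powr_mono2) (auto simp: field_simps)
      qed
    qed
    then have "Lp_var_norm p f \<le> ennreal (t / c)"
      using t c f by (intro Lp_var_norm_le) auto
    then have "ennreal c * Lp_var_norm p f \<le> ennreal c * ennreal (t / c)"
      by (rule mult_left_mono) simp
    also have "\<dots> = ennreal t"
      using c by (simp flip: ennreal_mult')
    finally show "ennreal c * Lp_var_norm p f \<le> ennreal t" .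
  qed
qed simp

lemma Lp_var_norm_le_cmult:
  assumes f: "f \<in> borel_measurable lebesgue" and p: "\<And>x. 0 \<le> p x" and c: "0 \<le> c"
    and le: "AE x in lebesgue. \<bar>f x\<bar> \<le> c * \<bar>g x\<bar>"
  shows "Lp_var_norm p f \<le> ennreal c * Lp_var_norm p g"
proof (cases "c = 0")
  \<comment> \<open>Here the right side is 0 even if \<open>g\<close> has infinite norm, so the norm
    of \<open>f\<close> must be shown to vanish.\<close>
  case True
  have "ennreal 1 * Lp_var_norm p f \<le> Lp_var_norm p (\<lambda>x. 0)"
    using le True by (intro cmult_Lp_var_norm_le f p) auto
  then show ?thesis by (simp add: Lp_var_norm_0)
next
  case False
  with c have c: "0 < c" by simp
  have "ennreal (1 / c) * Lp_var_norm p f \<le> Lp_var_norm p g"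
    using le c by (intro cmult_Lp_var_norm_le f p) (auto simp: field_simps)
  then have "ennreal c * (ennreal (1 / c) * Lp_var_norm p f) \<le> ennreal c * Lp_var_norm p g"
    by (rule mult_left_mono) simp
  then show ?thesis
    using c by (simp flip: ennreal_mult' mult.assoc)
qed

text \<open>For \<open>t\<close> at least 1 an exponent at least 1 gives
  \<open>(1 / t) powr p x \<le> 1 / t\<close>, so the modular is at most the volume divided by
  \<open>t\<close>.\<close>

lemma Lp_var_norm_cube_finite:
  fixes a :: "real ^ 'n"
  assumes l: "0 < l" and p: "\<And>x. 1 \<le> p x"
  shows "Lp_var_norm p (indicator (cube a l)) < \<infinity>"
proof -
  define t where "t = max 1 (l ^ CARD('n))"
  have t: "1 \<le> t" "l ^ CARD('n) \<le> t" by (auto simp: t_def)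
  have "modular p (indicator (cube a l)) t \<le> (\<integral>\<^sup>+ x. ennreal (1 / t) * indicator (cube a l) x \<partial>lebesgue)"
    unfolding modular_def
  proof (rule nn_integral_mono)
    fix x
    have "(1 / t) powr p x \<le> (1 / t) powr 1"
      using t p[of x] by (intro powr_mono') auto
    then show "ennreal ((\<bar>indicator (cube a l) x\<bar> / t) powr p x) \<le> ennreal (1 / t) * indicator (cube a l) x"
      using t by (auto simp: indicator_def intro: ennreal_leI)
  qed
  also have "\<dots> = ennreal (1 / t) * ennreal (l ^ CARD('n))"
    using l by (simp add: nn_integral_cmult_indicator emeasure_cube del: emeasure_completion)
  also have "\<dots> = ennreal (l ^ CARD('n) / t)"
    using l t by (simp flip: ennreal_mult')
  also have "\<dots> \<le> 1"
    using t l by (simp add: field_simps)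
  finally have "Lp_var_norm p (indicator (cube a l)) \<le> ennreal t"
    using t by (intro Lp_var_norm_le) auto
  then show ?thesis
    by (rule le_less_trans) simp
qed

text \<open>The reverse comparison: for \<open>t < 1\<close> the modular is at least the volume
  divided by \<open>t\<close>, which exceeds 1 once \<open>t\<close> is below the volume. With
  finiteness, this allows cancelling the norm of a cube in \<open>ennreal\<close>.\<close>

lemma Lp_var_norm_cube_pos:
  fixes a :: "real ^ 'n"
  assumes l: "0 < l" and p: "\<And>x. 1 \<le> p x"
  shows "0 < Lp_var_norm p (indicator (cube a l))"
proof -
  define s where "s = min 1 (l ^ CARD('n))"
  have s: "0 < s" using l by (simp add: s_def)
  have "ennreal s \<le> Lp_var_norm p (indicator (cube a l))"
  proof (rule Lp_var_norm_ge, rule ccontr)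
    fix t :: real
    assume t: "0 < t" and m: "modular p (indicator (cube a l)) t \<le> 1" and "\<not> ennreal s \<le> ennreal t"
    then have ts: "t < s" by (simp add: not_le ennreal_less_iff)
    then have t1: "t < 1" and tl: "t < l ^ CARD('n)" by (auto simp: s_def)
    have "1 < l ^ CARD('n) / t"
      using t tl by (simp add: field_simps)
    then have "1 < ennreal (l ^ CARD('n) / t)"
      by (simp flip: ennreal_1 add: ennreal_less_iff)
    also have "\<dots> = ennreal (1 / t) * ennreal (l ^ CARD('n))"
      using l t by (simp flip: ennreal_mult')
    also have "\<dots> = (\<integral>\<^sup>+ x. ennreal (1 / t) * indicator (cube a l) x \<partial>lebesgue)"
      using l by (simp add: nn_integral_cmult_indicator emeasure_cube del: emeasure_completion)
    also have "\<dots> \<le> modular p (indicator (cube a l)) t"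
      unfolding modular_def
    proof (rule nn_integral_mono)
      fix x
      have "(1 / t) powr 1 \<le> (1 / t) powr p x"
        using t t1 p[of x] by (intro powr_mono) auto
      then show "ennreal (1 / t) * indicator (cube a l) x \<le> ennreal ((\<bar>indicator (cube a l) x\<bar> / t) powr p x)"
        using t by (auto simp: indicator_def intro: ennreal_leI)
    qed
    finally show False using m by simp
  qed
  then show ?thesis
    using s by (metis ennreal_less_zero_iff less_le_trans)
qed

text \<open>
  The average of a nonnegative function over a cube is a lower bound on that cube for the maximal
  function of the truncation, so boundedness of the maximal operator alone gives the inequality
  which is usually derived from Hoelder's inequality and duality.
\<close>

lemma average_mult_norm_cube_le:
  fixes a :: "real ^ 'n"
  assumes p: "\<And>x. 1 \<le> p x"
    and C: "1 \<le> C"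
    and M: "\<And>f. f \<in> Lp_var p \<Longrightarrow> (AE x in lebesgue. maximal_fun f x < \<infinity>) \<and>
        Lp_var_norm p (\<lambda>x. enn2real (maximal_fun f x)) \<le> ennreal C * Lp_var_norm p f"
    and l: "0 < l"
  shows "(\<integral>\<^sup>+ x\<in>cube a l. ennreal \<bar>f x\<bar> \<partial>lebesgue) / emeasure lebesgue (cube a l)
           * Lp_var_norm p (indicator (cube a l))
         \<le> ennreal C * Lp_var_norm p (\<lambda>x. f x * indicator (cube a l) x)"
proof (cases "(\<lambda>x. f x * indicator (cube a l) x) \<in> Lp_var p")
  case False
  \<comment> \<open>The norm on the right is infinite, and \<open>1 \<le> C\<close> keeps the
    product infinite.\<close>
  then show ?thesis
    using C by (simp add: Lp_var_norm_def ennreal_mult_top)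
next
  case True
  let ?Q = "cube a l" and ?F = "\<lambda>x. f x * indicator (cube a l) x"
  define m where "m = (\<integral>\<^sup>+ x\<in>?Q. ennreal \<bar>f x\<bar> \<partial>lebesgue) / emeasure lebesgue ?Q"
  have ge: "m \<le> maximal_fun ?F x" if "x \<in> ?Q" for x
  proof -
    have "m = (\<integral>\<^sup>+ y\<in>?Q. ennreal \<bar>?F y\<bar> \<partial>lebesgue) / emeasure lebesgue ?Q"
      unfolding m_def
      by (intro arg_cong2[where f="(/)"] nn_integral_cong refl) (auto simp: indicator_def)
    then show ?thesis
      unfolding maximal_fun_def
      using that l by (auto intro!: SUP_upper simp: cube_in_cubes simp del: emeasure_completion)
  qed
  have fin: "AE x in lebesgue. maximal_fun ?F x < \<infinity>"
    and bd: "Lp_var_norm p (\<lambda>x. enn2real (maximal_fun ?F x)) \<le> ennreal C * Lp_var_norm p ?F"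
    using M[OF True] by auto
  \<comment> \<open>An infinite average would make the maximal function infinite on a set of
    positive measure. Finiteness is needed because \<open>enn2real\<close> sends infinity to
    0.\<close>
  have "m < \<infinity>"
  proof (rule ccontr)
    assume "\<not> m < \<infinity>"
    from fin have "AE x in lebesgue. x \<notin> ?Q"
    proof eventually_elim
      case (elim x)
      then show ?case using ge[of x] \<open>\<not> m < \<infinity>\<close> by (metis le_less_trans)
    qed
    then have "emeasure lebesgue ?Q = 0"
      by (subst (asm) AE_iff_measurable[of ?Q]) auto
    then show False
      using l by (simp add: emeasure_cube del: emeasure_completion)
  qed
  then have "m = ennreal (enn2real m)" by simp
  moreover have "ennreal (enn2real m) * Lp_var_norm p (indicator ?Q) 
      \<le> Lp_var_norm p (\<lambda>x. enn2real (maximal_fun ?F x))"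
  proof (rule cmult_Lp_var_norm_le)
    show "AE x in lebesgue. enn2real m * \<bar>indicator ?Q x\<bar> \<le> \<bar>enn2real (maximal_fun ?F x)\<bar>"
      using fin
    proof eventually_elim
      case (elim x)
      then show ?case using ge[of x] by (cases "x \<in> ?Q") (auto intro: enn2real_mono)
    qed
    show "0 \<le> p x" for x using p[of x] by simp
  qed auto
  ultimately show ?thesis
    using bd unfolding m_def by simp
qed

section \<open>Vanishing of functions with small integrals over cubes\<close>

text \<open>The bound decays faster than volume: \<open>N ^ n\<close> pieces of side
  \<open>l / N\<close> contribute in total at most \<open>K * l ^ n * (l / N) powr \<beta>\<close>,
  where \<open>n\<close> is the dimension, and this tends to 0.\<close>

lemma AE_zero_of_cube_bound:
  fixes h :: "real ^ 'n \<Rightarrow> ennreal"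
  assumes h [measurable]: "h \<in> borel_measurable lebesgue" and \<beta>: "0 < \<beta>"
    and bd: "\<And>a l. 0 < l \<Longrightarrow>
      (\<integral>\<^sup>+ x\<in>cube a l. h x \<partial>lebesgue) \<le> ennreal (K * l powr \<beta> * l ^ CARD('n))"
  shows "AE x in lebesgue. h x = 0"
proof -
  have zero: "(\<integral>\<^sup>+ x\<in>cube a l. h x \<partial>lebesgue) = 0" if l: "0 < l" for a :: "real ^ 'n" and l
  proof -
    \<comment> \<open>Viewing the integral as a measure gives finite subadditivity, which suffices
      although the closed pieces share faces.\<close>
    have dens: "emeasure (density lebesgue h) (cube c m) = (\<integral>\<^sup>+ x\<in>cube c m. h x \<partial>lebesgue)" for c m
      by (intro emeasure_density) auto
    have le: "(\<integral>\<^sup>+ x\<in>cube a l. h x \<partial>lebesgue)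
        \<le> ennreal (K * l ^ CARD('n) * (l / real (Suc k)) powr \<beta>)" for k
    proof -
      define N where "N = Suc k"
      have N: "0 < real N" by (simp add: N_def)
      define m where "m = l / real N"
      have m: "0 < m" "real N * m = l" using l N by (auto simp: m_def)
      define I where "I = (UNIV::'n set) \<rightarrow>\<^sub>E {..<N}"
      define c where "c i = (\<chi> j. a $ j + real (i j) * m)" for i :: "'n \<Rightarrow> nat"
      have fin: "finite I" unfolding I_def by (intro finite_PiE) auto
      have cardI: "card I = N ^ CARD('n)" unfolding I_def by (simp add: card_PiE)
      have cover: "cube a l \<subseteq> (\<Union>i\<in>I. cube (c i) m)"
      proof
        fix x assume "x \<in> cube a l"
        then have x: "a $ j \<le> x $ j" "x $ j \<le> a $ j + l" for j by (auto simp: mem_cube)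
        have "\<exists>p<N. a $ j + real p * m \<le> x $ j \<and> x $ j \<le> a $ j + real p * m + m" for j
        \<comment> \<open>On the upper face the floor would be \<open>N\<close>, one past the last
          index; the last piece, with index \<open>k = N - 1\<close>, takes these points.\<close>
        proof (cases "x $ j = a $ j + l")
          case True
          have "real k * m + m = l" using m(2) by (simp add: N_def distrib_right add.commute)
          then have "a $ j + real k * m \<le> x $ j" "x $ j \<le> a $ j + real k * m + m"
            using True m(1) by linarith+
          then show ?thesis by (intro exI[of _ k]) (simp add: N_def)
        next
          case False
          define p where "p = nat \<lfloor>(x $ j - a $ j) / m\<rfloor>"
          have "0 \<le> (x $ j - a $ j) / m" using x m by simp
          then have p: "real p \<le> (x $ j - a $ j) / m" "(x $ j - a $ j) / m < real p + 1"
            unfolding p_def by linarith+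
          have "(x $ j - a $ j) / m < real N"
            using False x[of j] m by (simp add: field_simps)
          then have "p < N" using p by linarith
          then show ?thesis using p m by (intro exI[of _ p]) (auto simp: field_simps)
        qed
        then obtain i where i: "\<And>j. i j < N" "\<And>j. a $ j + real (i j) * m \<le> x $ j \<and> 
            x $ j \<le> a $ j + real (i j) * m + m" by metis
        then have "i \<in> I" "x \<in> cube (c i) m" by (auto simp: I_def c_def mem_cube)
        then show "x \<in> (\<Union>i\<in>I. cube (c i) m)" by blast
      qed
      have "emeasure (density lebesgue h) (cube a l)
          \<le> emeasure (density lebesgue h) (\<Union>i\<in>I. cube (c i) m)"
        by (intro emeasure_mono cover sets.finite_UN fin) auto
      also have "\<dots> \<le> (\<Sum>i\<in>I. emeasure (density lebesgue h) (cube (c i) m))"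
        by (intro emeasure_subadditive_finite fin) auto
      also have "\<dots> \<le> (\<Sum>i\<in>I. ennreal (K * m powr \<beta> * m ^ CARD('n)))"
        unfolding dens by (intro sum_mono bd m)
      also have "\<dots> = ennreal (real (N ^ CARD('n))) * ennreal (K * m powr \<beta> * m ^ CARD('n))"
        by (simp only: sum_constant cardI ennreal_of_nat_eq_real_of_nat)
      also have "\<dots> = ennreal (K * l ^ CARD('n) * m powr \<beta>)"
        by (simp add: m(2)[symmetric] power_mult_distrib ac_simps flip: ennreal_mult')
      finally show ?thesis unfolding dens m_def N_def .
    qed
    have "(\<lambda>k. (l / real (Suc k)) powr \<beta>) \<longlonglongrightarrow> 0"
      using \<beta> l by (intro tendsto_zero_powrI[of _ _ "\<lambda>_. \<beta>"] LIMSEQ_Suc[OF lim_const_over_n]) auto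
    then have "(\<lambda>k. ennreal (K * l ^ CARD('n) * (l / real (Suc k)) powr \<beta>)) \<longlonglongrightarrow> ennreal 0"
      by (intro tendsto_ennrealI tendsto_mult_right_zero)
    then have "(\<integral>\<^sup>+ x\<in>cube a l. h x \<partial>lebesgue) \<le> ennreal 0"
      by (rule LIMSEQ_le_const) (use le in blast)
    then show ?thesis by simp
  qed
  \<comment> \<open>These cubes exhaust the space; the extra 1 in the side keeps it positive for
    \<open>k = 0\<close>.\<close>
  let ?Q = "\<lambda>k. cube (\<chi> i. - real k) (2 * real k + 1) :: (real ^ 'n) set"
  have "AE x in lebesgue. \<forall>k. h x * indicator (?Q k) x = 0"
    unfolding AE_all_countable
  proof
    fix k
    have "(\<integral>\<^sup>+ x\<in>?Q k. h x \<partial>lebesgue) = 0" by (intro zero) simp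
    then show "AE x in lebesgue. h x * indicator (?Q k) x = 0"
      by (subst (asm) nn_integral_0_iff_AE) auto
  qed
  then show ?thesis
  proof eventually_elim
    case (elim x)
    obtain k where "norm x \<le> real k" using real_arch_simple by blast
    then have "\<bar>x $ i\<bar> \<le> real k" for i
      using component_le_norm_cart[of x i] by linarith
    then have "- real k \<le> x $ i \<and> x $ i \<le> - real k + (2 * real k + 1)" for i
      by (smt (verit))
    then have "x \<in> ?Q k" by (simp add: mem_cube)
    then show ?case using elim[rule_format, of k] by simp
  qed
qed

section \<open>From mean oscillation to a Hoelder representative\<close>

text \<open>The exponent function has disappeared: only the \<open>L\<^sup>1\<close> oscillation
  enters. The bound is on the integral, not the average, hence the factor
  \<open>l ^ CARD('n)\<close>.\<close>

locale holder_mean_oscillation =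
  fixes b :: "real ^ 'n \<Rightarrow> real" and \<beta> K :: real
  assumes loc: "b \<in> L1_loc" and \<beta>: "0 < \<beta>" and K: "0 \<le> K"
    and osc: "\<And>a l. 0 < l \<Longrightarrow>
      (LINT x:cube a l|lebesgue. \<bar>b x - cube_avg (cube a l) b\<bar>) \<le> K * l powr \<beta> * l ^ CARD('n)"
begin

lemma set_integrable_cube: "set_integrable lebesgue (cube a l) b"
  using loc compact_cube unfolding L1_loc_def by blast

lemma set_integrable_cube_diff_const: "set_integrable lebesgue (cube a l) (\<lambda>x. b x - c)"
  using lmeasurable_cube[of a l]
  by (intro set_integral_diff set_integrable_cube)
    (auto simp: set_integrable_def fmeasurable_def intro!: integrable_mult_left)

lemma abs_cube_avg_diff_const_le:
  assumes l: "0 < l"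
  shows "\<bar>cube_avg (cube a l) b - c\<bar> \<le> (LINT x:cube a l|lebesgue. \<bar>b x - c\<bar>) / l ^ CARD('n)"
proof -
  have c: "set_integrable lebesgue (cube a l) (\<lambda>x. c)"
    using lmeasurable_cube[of a l] by (auto simp: set_integrable_def fmeasurable_def)
  have "(LINT x:cube a l|lebesgue. b x - c) = (LINT x:cube a l|lebesgue. b x) - l ^ CARD('n) * c"
    using l by (subst set_integral_diff(2)[OF set_integrable_cube c], subst set_integral_const)
      (auto simp: measure_cube emeasure_cube simp del: emeasure_completion measure_completion)
  then have "cube_avg (cube a l) b - c = (LINT x:cube a l|lebesgue. b x - c) / l ^ CARD('n)"
    using l by (simp add: cube_avg_def measure_cube field_simps del: measure_completion)
  then show ?thesis
    using l set_integral_norm_bound[OF set_integrable_cube_diff_const[where a = a and l = l and c = c]]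
    by (simp add: abs_divide divide_right_mono)
qed

text \<open>Subtract the average over the larger cube and enlarge the domain of integration.
  Dividing by the smaller volume costs at most \<open>2 ^ CARD('n)\<close> because
  \<open>m \<le> 2 * l\<close>.\<close>

lemma abs_cube_avg_diff_le:
  assumes sub: "cube a l \<subseteq> cube c m" and l: "0 < l" "0 < m" "m \<le> 2 * l"
  shows "\<bar>cube_avg (cube a l) b - cube_avg (cube c m) b\<bar> \<le> 2 ^ CARD('n) * K * m powr \<beta>"
proof -
  let ?c = "cube_avg (cube c m) b"
  have "(LINT x:cube a l|lebesgue. \<bar>b x - ?c\<bar>) \<le> (LINT x:cube c m|lebesgue. \<bar>b x - ?c\<bar>)"
    using sub set_integrable_abs[OF set_integrable_cube_diff_const]
    unfolding set_lebesgue_integral_def set_integrable_def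
    by (intro integral_mono) (auto simp: indicator_def)
  also have "\<dots> \<le> K * m powr \<beta> * m ^ CARD('n)"
    by (rule osc[OF l(2)])
  also have "\<dots> \<le> K * m powr \<beta> * (2 * l) ^ CARD('n)"
    using l K by (intro mult_left_mono power_mono) auto
  finally have "(LINT x:cube a l|lebesgue. \<bar>b x - ?c\<bar>) / l ^ CARD('n) 
      \<le> 2 ^ CARD('n) * K * m powr \<beta>"
    using l by (simp add: field_simps power_mult_distrib)
  then show ?thesis
    using abs_cube_avg_diff_const_le[OF l(1), of a ?c] by linarith
qed

text \<open>Sum of the geometric series with first term \<open>2 ^ CARD('n) * K\<close> and ratio
  \<open>2 powr (- \<beta>)\<close>: the total drift of the averages under repeated halving.\<close>

definition shrink_const :: real where
  "shrink_const = 2 ^ CARD('n) * K / (1 - 2 powr (- \<beta>))"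

lemma two_powr_less_1: "2 powr (- \<beta>) < 1"
  using \<beta> by (simp add: powr_less_one)

lemma shrink_const_nonneg: "0 \<le> shrink_const"
  using K two_powr_less_1 by (simp add: shrink_const_def)

text \<open>Telescoping along cubes with the same corner: the side is halved until it is within a
  factor 2 of \<open>s\<close>. The bound does not depend on \<open>s\<close>, which lets
  \<open>s\<close> tend to 0 later.\<close>

lemma abs_cube_avg_shrink_le:
  assumes "0 < s" "s \<le> r"
  shows "\<bar>cube_avg (cube x s) b - cube_avg (cube x r) b\<bar> \<le> shrink_const * r powr \<beta>"
proof -
  have "\<bar>cube_avg (cube x s) b - cube_avg (cube x r) b\<bar> \<le> shrink_const * r powr \<beta>"
    if "0 < s" "s \<le> r" "r \<le> 2 ^ k * s" for k r
    using that
  proof (induction k arbitrary: r)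
    case 0
    then have "s = r" by simp
    then show ?case using shrink_const_nonneg by simp
  next
    case (Suc k)
    \<comment> \<open>The first term of the series plus the remaining tail is the whole sum, so the
      induction closes with the same constant.\<close>
    have eq: "2 ^ CARD('n) * K * r powr \<beta> + shrink_const * (r / 2) powr \<beta> = shrink_const * r powr \<beta>"
    proof -
      have "2 ^ CARD('n) * K = shrink_const * (1 - 2 powr (- \<beta>))"
        using two_powr_less_1 \<beta> by (simp add: shrink_const_def)
      moreover have "(r / 2) powr \<beta> = r powr \<beta> * 2 powr (- \<beta>)"
        using Suc.prems by (simp add: powr_divide powr_minus field_simps)
      ultimately show ?thesis by (simp only:) (simp add: algebra_simps)
    qed
    show ?case
    proof (cases "r \<le> 2 * s")
      case True
      have "\<bar>cube_avg (cube x s) b - cube_avg (cube x r) b\<bar> \<le> 2 ^ CARD('n) * K * r powr \<beta>"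
        using Suc.prems True by (intro abs_cube_avg_diff_le cube_mono) auto
      moreover have "0 \<le> shrink_const * (r / 2) powr \<beta>"
        using shrink_const_nonneg by simp
      ultimately show ?thesis using eq by linarith
    next
      case False
      have "\<bar>cube_avg (cube x s) b - cube_avg (cube x (r / 2)) b\<bar> \<le> shrink_const * (r / 2) powr \<beta>"
        using Suc.prems False by (intro Suc.IH) auto
      moreover have "\<bar>cube_avg (cube x (r / 2)) b - cube_avg (cube x r) b\<bar>
          \<le> 2 ^ CARD('n) * K * r powr \<beta>"
        using Suc.prems by (intro abs_cube_avg_diff_le cube_mono) auto
      ultimately show ?thesis using eq by linarith
    qed
  qed
  moreover obtain k where "r / s < 2 ^ k"
    using real_arch_pow[of 2 "r / s"] by auto
  then have "r \<le> 2 ^ k * s"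
    using assms by (simp add: field_simps)
  ultimately show ?thesis
    using assms by blast
qed

text \<open>The point is the lowest corner of the cubes, not their centre; this keeps them nested,
  so that \<open>cube_mono\<close> applies.\<close>

definition rep :: "real ^ 'n \<Rightarrow> real" where
  "rep x = lim (\<lambda>k. cube_avg (cube x (1 / 2 ^ k)) b)"

text \<open>From index \<open>N\<close> on, all averages lie within
  \<open>shrink_const * (1 / 2 ^ N) powr \<beta>\<close> of the \<open>N\<close>-th one, so they
  form a Cauchy sequence.\<close>

lemma cube_avg_tendsto_rep: "(\<lambda>k. cube_avg (cube x (1 / 2 ^ k)) b) \<longlonglongrightarrow> rep x"
proof -
  let ?A = "\<lambda>k. cube_avg (cube x (1 / 2 ^ k)) b"
  have lim0: "(\<lambda>k. shrink_const * (1 / 2 ^ k) powr \<beta>) \<longlonglongrightarrow> 0"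
    using \<beta> by (intro tendsto_mult_right_zero tendsto_zero_powrI[of _ _ "\<lambda>_. \<beta>"])
      (auto intro!: LIMSEQ_divide_realpow_zero)
  have "Cauchy ?A"
  proof (rule metric_CauchyI)
    fix e :: real assume "0 < e"
    then obtain N where N: "\<bar>shrink_const * (1 / 2 ^ N) powr \<beta>\<bar> < e / 2"
      using LIMSEQ_D[OF lim0, of "e / 2"] by auto
    have "\<bar>?A k - ?A N\<bar> < e / 2" if "N \<le> k" for k
    proof -
      have "\<bar>?A k - ?A N\<bar> \<le> shrink_const * (1 / 2 ^ N) powr \<beta>"
        using that by (intro abs_cube_avg_shrink_le) (auto simp: field_simps power_increasing)
      then show ?thesis using N by linarith
    qed
    then have "dist (?A m) (?A k) < e" if "N \<le> m" "N \<le> k" for m k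
      using that by (smt (verit) dist_real_def field_sum_of_halves)
    then show "\<exists>M. \<forall>m\<ge>M. \<forall>k\<ge>M. dist (?A m) (?A k) < e" by blast
  qed
  then show ?thesis
    unfolding rep_def by (simp add: Cauchy_convergent_iff convergent_LIMSEQ_iff)
qed

lemma abs_rep_diff_corner_le:
  assumes r: "0 < r"
  shows "\<bar>rep x - cube_avg (cube x r) b\<bar> \<le> shrink_const * r powr \<beta>"
proof (rule LIMSEQ_le_const2)
  show "(\<lambda>k. \<bar>cube_avg (cube x (1 / 2 ^ k)) b - cube_avg (cube x r) b\<bar>)
      \<longlonglongrightarrow> \<bar>rep x - cube_avg (cube x r) b\<bar>"
    by (intro tendsto_intros cube_avg_tendsto_rep)
  have "(\<lambda>k. 1 / 2 ^ k :: real) \<longlonglongrightarrow> 0"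
    by (auto intro!: LIMSEQ_divide_realpow_zero)
  then have "eventually (\<lambda>k. 1 / 2 ^ k < r) sequentially"
    using r by (rule order_tendstoD)
  then show "\<exists>N. \<forall>k\<ge>N. \<bar>cube_avg (cube x (1 / 2 ^ k)) b - cube_avg (cube x r) b\<bar>
      \<le> shrink_const * r powr \<beta>"
    unfolding eventually_sequentially by (meson abs_cube_avg_shrink_le less_imp_le zero_less_divide_1_iff zero_less_numeral zero_less_power)
qed

text \<open>Room for two comparisons, each consisting of passing from the limit to a cube of side
  \<open>d\<close> and from there to a cube of side \<open>2 * d\<close>.\<close>

definition holder_const :: real where
  "holder_const = 2 * (shrink_const + 2 ^ CARD('n) * K * 2 powr \<beta>)"

lemma abs_cube_avg_diff_double_le:
  assumes "0 < d" "cube x d \<subseteq> cube z (2 * d)"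
  shows "\<bar>cube_avg (cube x d) b - cube_avg (cube z (2 * d)) b\<bar>
    \<le> 2 ^ CARD('n) * K * 2 powr \<beta> * d powr \<beta>"
  using abs_cube_avg_diff_le[OF assms(2)] assms(1) by (simp add: powr_mult)

text \<open>The cubes of side \<open>norm (x - y)\<close> with corners \<open>x\<close> and
  \<open>y\<close> lie in one cube of twice the side, whose average links the two values.\<close>

lemma lip_bound_rep: "lip_bound \<beta> rep holder_const"
  unfolding lip_bound_def
proof (intro allI)
  fix x y :: "real ^ 'n"
  define d where "d = norm (x - y)"
  show "\<bar>rep x - rep y\<bar> \<le> holder_const * norm (x - y) powr \<beta>"
  proof (cases "x = y")
    case False
    then have d: "0 < d" by (simp add: d_def)
    \<comment> \<open>The lowest corner of the box spanned by \<open>x\<close> and \<open>y\<close>;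
      both points exceed it by at most \<open>d\<close> in each coordinate.\<close>
    define z :: "real ^ 'n" where "z = (\<chi> i. min (x $ i) (y $ i))"
    have xy: "\<bar>x $ i - y $ i\<bar> \<le> d" for i
      using component_le_norm_cart[of "x - y" i] by (simp add: d_def)
    have "z $ i \<le> x $ i \<and> x $ i \<le> z $ i + d" "z $ i \<le> y $ i \<and> y $ i \<le> z $ i + d" for i
      using xy[of i] by (auto simp: z_def)
    then have sub: "cube x d \<subseteq> cube z (2 * d)" "cube y d \<subseteq> cube z (2 * d)"
      by (auto simp: subset_iff mem_cube) (smt (verit))+
    show ?thesis
      using abs_rep_diff_corner_le[OF d, of x] abs_rep_diff_corner_le[OF d, of y]
        abs_cube_avg_diff_double_le[OF d sub(1)] abs_cube_avg_diff_double_le[OF d sub(2)]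
      unfolding holder_const_def d_def[symmetric] by (simp add: algebra_simps)
  qed simp
qed

text \<open>Now \<open>x\<close> may lie anywhere in the cube, so the average over
  \<open>cube x l\<close> is compared with that over \<open>cube a l\<close> through the common cube
  \<open>cube a (2 * l)\<close>.\<close>

lemma abs_rep_diff_cube_avg_le:
  assumes l: "0 < l" and x: "x \<in> cube a l"
  shows "\<bar>rep x - cube_avg (cube a l) b\<bar> \<le> holder_const * l powr \<beta>"
proof -
  have sub: "cube x l \<subseteq> cube a (2 * l)" "cube a l \<subseteq> cube a (2 * l)"
    using x l by (auto simp: subset_iff mem_cube) (smt (verit))+
  \<comment> \<open>Only one corner estimate occurs here, while \<open>holder_const\<close> provides
    for two; the surplus is nonnegative.\<close>
  have "0 \<le> shrink_const * l powr \<beta>"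
    using shrink_const_nonneg by simp
  then show ?thesis
    using abs_rep_diff_corner_le[OF l, of x]
      abs_cube_avg_diff_double_le[OF l sub(1)] abs_cube_avg_diff_double_le[OF l sub(2)]
    unfolding holder_const_def by (simp add: algebra_simps)
qed

lemma holder_const_nonneg: "0 \<le> holder_const"
  using lip_bound_rep by (rule lip_bound_nonneg)

text \<open>Insert the cube average between \<open>b\<close> and \<open>rep\<close>. The first
  difference is controlled in the mean by \<open>osc\<close>, the second pointwise, and the sum has
  the decay required by \<open>AE_zero_of_cube_bound\<close>.\<close>

lemma AE_eq_rep: "AE x in lebesgue. b x = rep x"
proof -
  have b [measurable]: "b \<in> borel_measurable lebesgue"
    using loc by (simp add: L1_loc_def)
  have "rep \<in> borel_measurable borel"
    using lip_bound_continuous[OF lip_bound_rep \<beta>] by (rule borel_measurable_continuous_onI)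
  then have g [measurable]: "rep \<in> borel_measurable lebesgue"
    by (intro measurable_completion) simp
  have "AE x in lebesgue. ennreal \<bar>b x - rep x\<bar> = 0"
  proof (rule AE_zero_of_cube_bound[OF _ \<beta>])
    fix a :: "real ^ 'n" and l :: real assume l: "0 < l"
    let ?c = "cube_avg (cube a l) b" and ?n = "CARD('n)"
    have "(\<integral>\<^sup>+ x\<in>cube a l. ennreal \<bar>b x - rep x\<bar> \<partial>lebesgue)
        \<le> (\<integral>\<^sup>+ x. ennreal (indicator (cube a l) x * \<bar>b x - ?c\<bar>)
              + ennreal (holder_const * l powr \<beta>) * indicator (cube a l) x \<partial>lebesgue)"
    proof (rule nn_integral_mono)
      fix x
      show "ennreal \<bar>b x - rep x\<bar> * indicator (cube a l) x
          \<le> ennreal (indicator (cube a l) x * \<bar>b x - ?c\<bar>)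
            + ennreal (holder_const * l powr \<beta>) * indicator (cube a l) x"
        using abs_rep_diff_cube_avg_le[OF l, of x a] holder_const_nonneg
        by (auto simp: indicator_def simp flip: ennreal_plus intro!: ennreal_leI)
    qed
    also have "\<dots> = (\<integral>\<^sup>+ x. ennreal (indicator (cube a l) x * \<bar>b x - ?c\<bar>) \<partial>lebesgue)
        + ennreal (holder_const * l powr \<beta>) * emeasure lebesgue (cube a l)"
      by (subst nn_integral_add) (auto simp: nn_integral_cmult_indicator simp del: emeasure_completion)
    also have "(\<integral>\<^sup>+ x. ennreal (indicator (cube a l) x * \<bar>b x - ?c\<bar>) \<partial>lebesgue)
        = ennreal (LINT x:cube a l|lebesgue. \<bar>b x - ?c\<bar>)"
      using set_integrable_abs[OF set_integrable_cube_diff_const[of a l ?c]]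
      unfolding set_lebesgue_integral_def set_integrable_def
      by (subst nn_integral_eq_integral) auto
    also have "\<dots> \<le> ennreal (K * l powr \<beta> * l ^ ?n)"
      by (intro ennreal_leI osc l)
    also have "ennreal (K * l powr \<beta> * l ^ ?n) + ennreal (holder_const * l powr \<beta>) * emeasure lebesgue (cube a l)
        = ennreal ((K + holder_const) * l powr \<beta> * l ^ ?n)"
      using l K holder_const_nonneg
      by (simp add: emeasure_cube distrib_right flip: ennreal_mult' ennreal_plus del: emeasure_completion)
    finally show "(\<integral>\<^sup>+ x\<in>cube a l. ennreal \<bar>b x - rep x\<bar> \<partial>lebesgue)
        \<le> ennreal ((K + holder_const) * l powr \<beta> * l ^ ?n)"
      by (simp add: add_right_mono)
  qed measurable
  then show ?thesis by simp
qed

end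

section \<open>The two norm inequalities\<close>

text \<open>On a cube of side \<open>l\<close> the continuous representative oscillates by at most a
  multiple \<open>w\<close> of \<open>l powr \<beta>\<close>. Hence \<open>b\<close> differs from
  its average by at most \<open>w\<close> almost everywhere there, and the quotient of norms is at
  most \<open>w\<close>.\<close>

lemma lip_space_mean_norm_le:
  fixes b :: "real ^ 'n \<Rightarrow> real"
  assumes \<beta>: "0 < \<beta>" and p: "\<And>x. 1 \<le> p x" and b: "b \<in> lip_space \<beta>"
  shows "b \<in> L1_loc"
    and "lip_mean_norm \<beta> p b \<le> ennreal (real CARD('n) powr \<beta> * lip_norm \<beta> b)"
proof -
  define L where "L = lip_norm \<beta> b"
  obtain g where g: "AE x in lebesgue. b x = g x" "lip_bound \<beta> g L"
    using lip_norm_least(1)[OF \<beta> b] unfolding L_def by blast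
  have L: "0 \<le> L" using g(2) by (rule lip_bound_nonneg)
  have cont: "continuous_on UNIV g" by (rule lip_bound_continuous[OF g(2) \<beta>])
  then have "g \<in> borel_measurable borel" by (rule borel_measurable_continuous_onI)
  then have gm: "g \<in> borel_measurable lebesgue" by (intro measurable_completion) simp
  have bm [measurable]: "b \<in> borel_measurable lebesgue"
    using gm by (rule borel_measurable_AE) (use g(1) in auto)
  show loc: "b \<in> L1_loc"
    unfolding L1_loc_def
  proof (intro CollectI conjI allI impI bm)
    fix S :: "(real ^ 'n) set" assume S: "compact S"
    have "set_integrable lborel S g"
      using borel_integrable_compact[OF S continuous_on_subset[OF cont]]
      by (simp add: set_integrable_def)
    then have "set_integrable lebesgue S g"
      using S unfolding set_integrable_def
      by (subst integrable_completion) (auto dest: borel_measurable_integrable)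
    then show "set_integrable lebesgue S b"
      using S g(1) gm bm by (subst set_integrable_cong_AE[of _ _ g]) (auto intro: fmeasurableD lmeasurable_compact)
  qed
  show "lip_mean_norm \<beta> p b \<le> ennreal (real CARD('n) powr \<beta> * lip_norm \<beta> b)"
    unfolding lip_mean_norm_def
  proof (rule SUP_least)
    fix Q :: "(real ^ 'n) set" assume "Q \<in> cubes"
    then obtain a l where Q: "Q = cube a l" and l: "0 < l" by (auto simp: cubes_eq)
    define w where "w = L * (real CARD('n) * l) powr \<beta>"
    have w: "0 \<le> w" using L by (simp add: w_def)
    have gd: "\<bar>g x - g y\<bar> \<le> w" if "x \<in> Q" "y \<in> Q" for x y
    proof -
      have "norm (x - y) powr \<beta> \<le> (real CARD('n) * l) powr \<beta>"
        using that \<beta> by (intro powr_mono2 norm_diff_cube) (auto simp: Q)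
      then have "L * norm (x - y) powr \<beta> \<le> w"
        unfolding w_def using L by (rule mult_left_mono)
      then show ?thesis
        using g(2) unfolding lip_bound_def by (meson order_trans)
    qed
    have int: "set_integrable lebesgue Q b"
      using loc compact_cube unfolding L1_loc_def Q by blast
    have const: "set_integrable lebesgue Q (\<lambda>x. c)" for c :: real
      using lmeasurable_cube[of a l] by (auto simp: set_integrable_def fmeasurable_def Q)
    have intc: "(LINT x:Q|lebesgue. c) = l ^ CARD('n) * c" for c :: real
      using l unfolding Q by (subst set_integral_const)
        (auto simp: measure_cube emeasure_cube simp del: emeasure_completion measure_completion)
    have avg: "\<bar>g x - cube_avg Q b\<bar> \<le> w" if x: "x \<in> Q" for x
    proof -
      \<comment> \<open>Integrating these two bounds puts the average of \<open>b\<close> within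
        \<open>w\<close> of every value of \<open>g\<close> on the cube.\<close>
      have ae: "AE y\<in>Q in lebesgue. g x - w \<le> b y" "AE y\<in>Q in lebesgue. b y \<le> g x + w"
        using g(1) by (eventually_elim, use gd[OF x] in \<open>force simp: abs_le_iff\<close>)+
      have "l ^ CARD('n) * (g x - w) \<le> (LINT y:Q|lebesgue. b y)"
        using set_integral_mono_AE[OF const int ae(1)] by (simp add: intc)
      moreover have "(LINT y:Q|lebesgue. b y) \<le> l ^ CARD('n) * (g x + w)"
        using set_integral_mono_AE[OF int const ae(2)] by (simp add: intc)
      ultimately have "g x - w \<le> cube_avg Q b" "cube_avg Q b \<le> g x + w"
        using l by (auto simp: cube_avg_def Q measure_cube field_simps simp del: measure_completion)
      then show ?thesis by linarith
    qed
    have N: "0 < Lp_var_norm p (indicator Q)" "Lp_var_norm p (indicator Q) < \<infinity>"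
      unfolding Q using Lp_var_norm_cube_pos[OF l p] Lp_var_norm_cube_finite[OF l p] by auto
    have "Lp_var_norm p (\<lambda>x. (b x - cube_avg Q b) * indicator Q x)
        \<le> ennreal w * Lp_var_norm p (indicator Q)"
    proof (rule Lp_var_norm_le_cmult[OF _ _ w])
      have [measurable]: "Q \<in> sets lebesgue" by (simp add: Q)
      show "(\<lambda>x. (b x - cube_avg Q b) * indicator Q x) \<in> borel_measurable lebesgue"
        by measurable
      show "0 \<le> p x" for x using p[of x] by simp
      show "AE x in lebesgue. \<bar>(b x - cube_avg Q b) * indicator Q x\<bar> \<le> w * \<bar>indicator Q x\<bar>"
        using g(1) by eventually_elim (auto simp: indicator_def avg)
    qed
    then have "Lp_var_norm p (\<lambda>x. (b x - cube_avg Q b) * indicator Q x) / Lp_var_norm p (indicator Q)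
        \<le> ennreal w * Lp_var_norm p (indicator Q) / Lp_var_norm p (indicator Q)"
      by (rule divide_right_mono_ennreal)
    also have "\<dots> = ennreal w"
      using N by (intro mult_divide_eq_ennreal) auto
    finally have "ennreal (1 / measure lebesgue Q powr (\<beta> / real CARD('n))) *
        (Lp_var_norm p (\<lambda>x. (b x - cube_avg Q b) * indicator Q x) / Lp_var_norm p (indicator Q))
        \<le> ennreal (1 / measure lebesgue Q powr (\<beta> / real CARD('n))) * ennreal w"
      by (rule mult_left_mono) simp
    also have "\<dots> = ennreal (1 / l powr \<beta>) * ennreal w"
      by (simp only: Q measure_cube_powr[OF l])
    also have "\<dots> = ennreal (real CARD('n) powr \<beta> * L)"
      using l by (simp add: w_def powr_mult mult.commute flip: ennreal_mult')
    finally show "ennreal (1 / measure lebesgue Q powr (\<beta> / real CARD('n))) *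
        (Lp_var_norm p (\<lambda>x. (b x - cube_avg Q b) * indicator Q x) / Lp_var_norm p (indicator Q))
        \<le> ennreal (real CARD('n) powr \<beta> * lip_norm \<beta> b)" 
      unfolding L_def .
  qed
qed

text \<open>By \<open>average_mult_norm_cube_le\<close>, the average of
  \<open>\<bar>b - cube_avg Q b\<bar>\<close> over \<open>Q\<close> is at most \<open>C\<close>
  times the quotient of norms, thus at most \<open>C * A * l powr \<beta>\<close>. This is the
  locale hypothesis with \<open>K = C * A\<close>.\<close>

lemma lip_norm_le_of_mean_norm_le:
  fixes b :: "real ^ 'n \<Rightarrow> real"
  assumes \<beta>: "0 < \<beta>" and p: "\<And>x. 1 \<le> p x"
    and C: "1 \<le> C"
    and M: "\<And>f. f \<in> Lp_var p \<Longrightarrow> (AE x in lebesgue. maximal_fun f x < \<infinity>) \<and>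
        Lp_var_norm p (\<lambda>x. enn2real (maximal_fun f x)) \<le> ennreal C * Lp_var_norm p f"
    and b: "b \<in> L1_loc" and A: "0 \<le> A" and le: "lip_mean_norm \<beta> p b \<le> ennreal A"
  shows "b \<in> lip_space \<beta>"
    and "lip_norm \<beta> b \<le>
      2 * 2 ^ CARD('n) * (1 / (1 - 2 powr (- \<beta>)) + 2 powr \<beta>) * C * A"
proof -
  interpret holder_mean_oscillation b \<beta> "C * A"
  proof
    show "b \<in> L1_loc" "0 < \<beta>" "0 \<le> C * A" using b \<beta> C A by auto
    fix a :: "real ^ 'n" and l :: real assume l: "0 < l"
    let ?Q = "cube a l"
    define f where "f x = b x - cube_avg ?Q b" for x
    define I where "I = (LINT x:?Q|lebesgue. \<bar>f x\<bar>)"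
    define N where "N = Lp_var_norm p (indicator ?Q)"
    define F where "F = Lp_var_norm p (\<lambda>x. f x * indicator ?Q x)"
    have N: "0 < N" "N < \<infinity>"
      unfolding N_def using Lp_var_norm_cube_pos[OF l p] Lp_var_norm_cube_finite[OF l p] by auto
    have "set_integrable lebesgue ?Q b"
      using b compact_cube unfolding L1_loc_def by blast
    then have "set_integrable lebesgue ?Q (\<lambda>x. \<bar>f x\<bar>)"
      unfolding f_def using lmeasurable_cube[of a l]
      by (intro set_integrable_abs set_integral_diff)
        (auto simp: set_integrable_def fmeasurable_def)
    then have nn: "(\<integral>\<^sup>+ x\<in>?Q. ennreal \<bar>f x\<bar> \<partial>lebesgue) = ennreal I"
      unfolding I_def set_lebesgue_integral_def set_integrable_def
      by (subst nn_integral_eq_integral[symmetric])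
        (auto intro!: nn_integral_cong simp: indicator_def)
    have I: "0 \<le> I"
      unfolding I_def set_lebesgue_integral_def by (intro integral_nonneg_AE) auto
    have "ennreal (1 / l powr \<beta>) * (F / N) \<le> lip_mean_norm \<beta> p b"
      unfolding lip_mean_norm_def F_def N_def f_def
      using SUP_upper[OF cube_in_cubes[OF l, of a]] by (simp only: measure_cube_powr[OF l, of a, symmetric])
    with le have "ennreal (1 / l powr \<beta>) * (F / N) \<le> ennreal A" by (rule order_trans[rotated])
    then have "ennreal (l powr \<beta>) * (ennreal (1 / l powr \<beta>) * (F / N)) \<le> ennreal (l powr \<beta>) * ennreal A"
      by (rule mult_left_mono) simp
    then have FN: "F / N \<le> ennreal (l powr \<beta> * A)"
      using l by (simp flip: ennreal_mult' mult.assoc)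
    have "ennreal (I / l ^ CARD('n)) * N \<le> ennreal C * F"
      using average_mult_norm_cube_le[OF p C M l, of f a] l I
      by (simp add: nn emeasure_cube divide_ennreal N_def F_def del: emeasure_completion)
    then have "ennreal (I / l ^ CARD('n)) * N / N \<le> ennreal C * F / N"
      by (rule divide_right_mono_ennreal)
    also have "ennreal (I / l ^ CARD('n)) * N / N = ennreal (I / l ^ CARD('n))"
      using N by (intro mult_divide_eq_ennreal) auto
    also have "ennreal C * F / N = ennreal C * (F / N)"
      by (simp add: ennreal_times_divide)
    also have "\<dots> \<le> ennreal C * ennreal (l powr \<beta> * A)"
      by (rule mult_left_mono[OF FN]) simp
    also have "\<dots> = ennreal (C * A * l powr \<beta>)"
      using C by (simp add: ac_simps flip: ennreal_mult')
    finally have "I / l ^ CARD('n) \<le> C * A * l powr \<beta>"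
      using C A by (subst (asm) ennreal_le_iff) auto
    then show "(LINT x:?Q|lebesgue. \<bar>b x - cube_avg ?Q b\<bar>) \<le> C * A * l powr \<beta> * l ^ CARD('n)"
      using l by (simp add: I_def f_def pos_divide_le_eq)
  qed
  show mem: "b \<in> lip_space \<beta>"
    unfolding lip_space_def using AE_eq_rep lip_bound_rep by blast
  have "lip_norm \<beta> b \<le> holder_const"
    by (rule lip_norm_least(2)[OF \<beta> mem AE_eq_rep lip_bound_rep])
  also have "\<dots> = 2 * 2 ^ CARD('n) * (1 / (1 - 2 powr (- \<beta>)) + 2 powr \<beta>) * C * A"
    unfolding holder_const_def shrink_const_def by (simp add: algebra_simps)
  finally show "lip_norm \<beta> b \<le> 2 * 2 ^ CARD('n) * (1 / (1 - 2 powr (- \<beta>)) + 2 powr \<beta>) * C * A" .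
qed

theorem theorem1p4:
  fixes \<beta> :: real
  assumes "0 < \<beta>" and "\<beta> < 1"
  shows "\<forall>q \<in> (exponents_B :: (real ^ 'n \<Rightarrow> real) set).
    (lip_space \<beta> :: (real ^ 'n \<Rightarrow> real) set) = lip_mean_space \<beta> q \<and>
    (\<exists>C1 > 0. \<exists>C2 > 0. \<forall>b \<in> (lip_space \<beta> :: (real ^ 'n \<Rightarrow> real) set).
       ennreal (C1 * lip_norm \<beta> b) \<le> lip_mean_norm \<beta> q b \<and>
       lip_mean_norm \<beta> q b \<le> ennreal (C2 * lip_norm \<beta> b))"
proof
  fix q :: "real ^ 'n \<Rightarrow> real" assume q: "q \<in> exponents_B"
  then have p: "\<And>x. 1 \<le> q x" by (auto simp: exponents_B_def exponents_P_def)
  obtain C0 :: real where C0: "\<And>f. f \<in> Lp_var q \<Longrightarrow> (AE x in lebesgue. maximal_fun f x < \<infinity>) \<and>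
     Lp_var_norm q (\<lambda>x. enn2real (maximal_fun f x)) \<le> ennreal C0 * Lp_var_norm q f"
    using q by (auto simp: exponents_B_def)
  \<comment> \<open>Enlarging the operator bound is harmless and supplies the hypothesis
    \<open>1 \<le> C\<close> of the lemmas above.\<close>
  define C where "C = max 1 C0"
  have C: "1 \<le> C" by (simp add: C_def)
  have M: "(AE x in lebesgue. maximal_fun f x < \<infinity>) \<and>
     Lp_var_norm q (\<lambda>x. enn2real (maximal_fun f x)) \<le> ennreal C * Lp_var_norm q f"
    if "f \<in> Lp_var q" for f
  proof -
    have "ennreal C0 * Lp_var_norm q f \<le> ennreal C * Lp_var_norm q f"
      by (intro mult_right_mono ennreal_leI) (auto simp: C_def)
    then show ?thesis using C0[OF that] by (auto intro: order_trans)
  qed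
  define E where "E = 2 * 2 ^ CARD('n) * (1 / (1 - 2 powr (- \<beta>)) + 2 powr \<beta>) * C"
  have "2 powr (- \<beta>) < 1" using assms(1) by (simp add: powr_less_one)
  then have "0 < 1 / (1 - 2 powr (- \<beta>)) + 2 powr \<beta>" by (intro add_pos_pos) auto
  then have E: "0 < E" using C by (simp add: E_def)
  \<comment> \<open>The mean norm itself serves as \<open>A\<close>; since it is finite,
    \<open>enn2real\<close> loses nothing. This yields \<open>C1 = 1 / E\<close>, while
    \<open>C2\<close> is \<open>CARD('n) powr \<beta>\<close>.\<close>
  have lower: "b \<in> lip_space \<beta> \<and> lip_norm \<beta> b \<le> E * enn2real (lip_mean_norm \<beta> q b)"
    if "b \<in> L1_loc" "lip_mean_norm \<beta> q b < \<infinity>" for b :: "real ^ 'n \<Rightarrow> real"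
    using lip_norm_le_of_mean_norm_le[OF assms(1) p C M that(1), of "enn2real (lip_mean_norm \<beta> q b)"]
      that(2) unfolding E_def by simp
  note upper = lip_space_mean_norm_le[where p = q, OF assms(1) p]
  have fin: "lip_mean_norm \<beta> q b < \<infinity>" if "b \<in> lip_space \<beta>" for b :: "real ^ 'n \<Rightarrow> real"
    using upper(2)[OF that] by (rule le_less_trans) simp
  have "(lip_space \<beta> :: (real ^ 'n \<Rightarrow> real) set) = lip_mean_space \<beta> q"
    using lower upper(1) fin by (auto simp: lip_mean_space_def)
  moreover have "ennreal (1 / E * lip_norm \<beta> b) \<le> lip_mean_norm \<beta> q b"
    if "b \<in> lip_space \<beta>" for b :: "real ^ 'n \<Rightarrow> real"
  proof -
    have "1 / E * lip_norm \<beta> b \<le> enn2real (lip_mean_norm \<beta> q b)"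
      using lower[OF upper(1)[OF that] fin[OF that]] E by (simp add: field_simps)
    then have "ennreal (1 / E * lip_norm \<beta> b) \<le> ennreal (enn2real (lip_mean_norm \<beta> q b))"
      by (rule ennreal_leI)
    also have "\<dots> = lip_mean_norm \<beta> q b"
      using fin[OF that] by simp
    finally show ?thesis .
  qed
  moreover have "0 < 1 / E" "0 < real CARD('n) powr \<beta>" using E by auto
  ultimately show "(lip_space \<beta> :: (real ^ 'n \<Rightarrow> real) set) = lip_mean_space \<beta> q \<and>
    (\<exists>C1 > 0. \<exists>C2 > 0. \<forall>b \<in> (lip_space \<beta> :: (real ^ 'n \<Rightarrow> real) set).
       ennreal (C1 * lip_norm \<beta> b) \<le> lip_mean_norm \<beta> q b \<and>
       lip_mean_norm \<beta> q b \<le> ennreal (C2 * lip_norm \<beta> b))"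
    using upper(2) by blast
qed

end
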